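(* Let $\mathcal{X}$ be a finite set with $|\mathcal{X}|\ge2$. Let $\mathcal{W}$ be the set of entrywise positive row-stochastic matrices on $\mathcal{X}$, $\mathcal{W}_{\mathsf{iid}}\subset\mathcal{W}$ the subset of memoryless kernels and $\mathcal{W}_{\mathsf{rev}}\subset\mathcal{W}$ the subset of reversible kernels. Then $$\text{m-hull}(\mathcal{W}_{\mathsf{iid}})=\mathcal{W}_{\mathsf{rev}}.$$
   Context: For $P\in\mathcal{W}$ with stationary distribution $\pi$, the edge measure is $Q(x,x')=\pi(x)P(x,x')$; $\mathcal{Q}$ is the set of edge measures of elements of $\mathcal{W}$, and $P\mapsto Q$ is a bijection $\mathcal{W}\to\mathcal{Q}$. $P$ is memoryless if all its rows are equal, $P(x,x')=\pi(x')$ for all $x,x'$ (with $\pi$ a positive distribution). $P$ is reversible if $\pi(x)P(x,x')=\pi(x')P(x',x)$ for all $x,x'$. For $\mathcal{V}\subset\mathcal{W}$, the mixture hull is $$\text{m-hull}(\mathcal{V})=\Big\{P:Q\in\mathcal{Q},\ Q=\sum_{i=1}^k\alpha_iQ_i,\ k\in\mathbb{N},\ \alpha_1,\dots,\alpha_k\in\mathbb{R},\ P_1,\dots,P_k\in\mathcal{V}\Big\},$$ where $Q$ (resp. $Q_i$) is the edge measure of $P$ (resp. $P_i$). *)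

theory Defs
  imports "HOL-Analysis.Analysis"
begin

text \<open>
  The state space is the universe of a type \<open>'x\<close> of class \<open>finite\<close>. A kernel
  \<open>P\<close> is a square matrix with rows indexed by the source state: \<open>P $ x $ x'\<close> is the
  probability of a transition from \<open>x\<close> to \<open>x'\<close>.
\<close>

definition distribution :: "real ^ 'x \<Rightarrow> bool" where
  "distribution p \<longleftrightarrow> (\<forall>x. p $ x \<ge> 0) \<and> (\<Sum>x\<in>UNIV. p $ x) = 1"

definition W :: "(real ^ 'x ^ 'x) set" where
  "W = {P. (\<forall>x x'. P $ x $ x' > 0) \<and> (\<forall>x. (\<Sum>x'\<in>UNIV. P $ x $ x') = 1)}"

definition stationary_dist :: "real ^ 'x ^ 'x \<Rightarrow> real ^ 'x" where
  "stationary_dist P = (THE p. distribution p \<and> p v* P = p)"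

definition edge_measure :: "real ^ 'x ^ 'x \<Rightarrow> real ^ 'x ^ 'x" where
  "edge_measure P = (\<chi> x x'. stationary_dist P $ x * P $ x $ x')"

definition memoryless :: "real ^ 'x ^ 'x \<Rightarrow> bool" where
  "memoryless P \<longleftrightarrow>
     (\<exists>p. distribution p \<and> (\<forall>x. p $ x > 0) \<and> (\<forall>x x'. P $ x $ x' = p $ x'))"

definition reversible :: "real ^ 'x ^ 'x \<Rightarrow> bool" where
  "reversible P \<longleftrightarrow>
     (\<forall>x x'. stationary_dist P $ x * P $ x $ x' = stationary_dist P $ x' * P $ x' $ x)"

definition W_iid :: "(real ^ 'x ^ 'x) set" where
  "W_iid = {P \<in> W. memoryless P}"

definition W_rev :: "(real ^ 'x ^ 'x) set" where
  "W_rev = {P \<in> W. reversible P}"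

text \<open>
  The coefficients of the combination are arbitrary reals: neither nonnegativity nor
  \<open>\<Sum>i. \<alpha> i = 1\<close> is imposed, the latter being forced since every edge measure
  has total mass 1. For the same reason the empty combination \<open>k = 0\<close> contributes
  nothing. That the combination is an edge measure is expressed by its being
  \<open>edge_measure P\<close> for some \<open>P \<in> W\<close>.
\<close>

definition m_hull :: "(real ^ 'x ^ 'x) set \<Rightarrow> (real ^ 'x ^ 'x) set" where
  "m_hull V = {P \<in> W. \<exists>(k::nat) (\<alpha> :: nat \<Rightarrow> real) (Ps :: nat \<Rightarrow> real ^ 'x ^ 'x).
     (\<forall>i\<in>{1..k}. Ps i \<in> V) \<and>
     edge_measure P = (\<Sum>i = 1..k. \<alpha> i *\<^sub>R edge_measure (Ps i))}"

text \<open>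
  On \<^const>\<open>W\<close> the description in \<^const>\<open>stationary_dist\<close> is proper: a stationary
  distribution exists, by Brouwer's fixed point theorem on the simplex, and is unique.
\<close>

lemma stationary_pos:
  fixes P :: "real ^ 'x ^ 'x"
  assumes "P \<in> W" "\<forall>x. r $ x \<ge> 0" "r v* P = r" "r $ x0 = 0"
  shows "r = 0"
proof -
  have "(\<Sum>x\<in>UNIV. r $ x * P $ x $ x0) = (r v* P) $ x0"
    by (simp add: vector_matrix_mult_def)
  also have "\<dots> = 0"
    using assms(3,4) by simp
  finally have sum0: "(\<Sum>x\<in>UNIV. r $ x * P $ x $ x0) = 0" .
  have P: "P $ x $ x0 > 0" for x
    using assms(1) by (simp add: W_def)
  have "r $ x * P $ x $ x0 = 0" for x
    using sum_nonneg_0[OF _ _ sum0, of x] assms(2) P by (simp add: less_imp_le)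
  then have "r $ x = 0" for x
    using P[of x] by (metis less_irrefl mult_eq_0_iff)
  then show ?thesis
    by (simp add: vec_eq_iff)
qed

lemma stationary_ex1:
  fixes P :: "real ^ 'x ^ 'x"
  assumes P: "P \<in> W"
  shows "\<exists>!p. distribution p \<and> p v* P = p"
proof (rule ex_ex1I)
  define S where "S = {p :: real ^ 'x. distribution p}"
  have S_eq: "S = {p. \<forall>x. 0 \<le> p $ x} \<inter> {p. (\<Sum>x\<in>UNIV. p $ x) = 1}"
    by (auto simp: S_def distribution_def)
  have "closed S"
    unfolding S_eq
    by (intro closed_Int closed_Collect_all closed_Collect_le closed_Collect_eq continuous_intros)
  moreover have "bounded S"
  proof (rule boundedI)
    fix p assume "p \<in> S"
    then show "norm p \<le> 1"
      using norm_le_l1_cart[of p] by (simp add: S_def distribution_def)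
  qed
  ultimately have "compact S"
    by (simp add: compact_eq_bounded_closed)
  moreover have "convex S"
    by (auto simp: convex_def S_def distribution_def sum.distrib simp flip: sum_distrib_left)
  moreover have "S \<noteq> {}"
  proof -
    have "axis undefined 1 \<in> S"
      by (auto simp: S_def distribution_def axis_def)
    then show ?thesis by blast
  qed
  moreover have "continuous_on S (\<lambda>p. p v* P)"
    unfolding vector_matrix_mult_def by (intro continuous_intros)
  moreover have "(\<lambda>p. p v* P) \<in> S \<rightarrow> S"
  proof
    fix p assume p: "p \<in> S"
    have "(\<Sum>x'\<in>UNIV. \<Sum>x\<in>UNIV. p $ x * P $ x $ x') = (\<Sum>x\<in>UNIV. \<Sum>x'\<in>UNIV. p $ x * P $ x $ x')"
      by (rule sum.swap)
    also have "\<dots> = 1"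
      using P p by (simp add: W_def S_def distribution_def flip: sum_distrib_left)
    finally show "p v* P \<in> S"
      using P p
      by (auto simp: W_def S_def distribution_def vector_matrix_mult_def less_imp_le intro!: sum_nonneg)
  qed
  ultimately obtain p where "p \<in> S" "p v* P = p"
    using brouwer by metis
  then show "\<exists>p. distribution p \<and> p v* P = p"
    by (auto simp: S_def)
next
  fix p q
  assume "distribution p \<and> p v* P = p" "distribution q \<and> q v* P = q"
  then have p: "distribution p" "p v* P = p" and q: "distribution q" "q v* P = q"
    by auto
  have "q \<noteq> 0" using q(1) by (auto simp: distribution_def)
  then have q_pos: "q $ x > 0" for x
    using stationary_pos[OF P _ q(2)] q(1) by (metis distribution_def order_less_le)
  define c where "c = Min (range (\<lambda>x. p $ x / q $ x))"
  have "c \<in> range (\<lambda>x. p $ x / q $ x)"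
    unfolding c_def by (rule Min_in) auto
  then obtain x0 where x0: "c = p $ x0 / q $ x0" by blast
  have c_le: "c \<le> p $ x / q $ x" for x
    unfolding c_def by (rule Min_le) auto
  have "(p - c *\<^sub>R q) v* P = p - c *\<^sub>R q"
  proof -
    have "(p - c *\<^sub>R q) v* P = p v* P - c *\<^sub>R (q v* P)"
      by (simp add: vec_eq_iff vector_matrix_mult_def algebra_simps sum_subtractf sum_distrib_left)
    then show ?thesis using p(2) q(2) by simp
  qed
  moreover have "\<forall>x. (p - c *\<^sub>R q) $ x \<ge> 0"
    using c_le q_pos by (simp add: pos_le_divide_eq)
  moreover have "(p - c *\<^sub>R q) $ x0 = 0"
    using x0 q_pos[of x0] by simp
  ultimately have pq: "p = c *\<^sub>R q"
    using stationary_pos[OF P, of "p - c *\<^sub>R q"] by simp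
  then have "c = 1"
    using p(1) q(1) by (simp add: distribution_def flip: sum_distrib_left)
  with pq show "p = q" by simp
qed

end

theory Submission
  imports Defs
begin

text \<open>
  The edge measure of a memoryless kernel with rows \<open>p\<close> is the symmetric rank-one matrix
  \<open>p p\<^sup>T\<close>, so it remains to see that these matrices span all symmetric matrices. After
  rescaling, the span contains \<open>v v\<^sup>T\<close> for every positive vector \<open>v\<close>. If \<open>u\<close> is positive and
  \<open>a\<close>, \<open>b\<close> are nonnegative, then inclusion-exclusion over \<open>u + a + b\<close>, \<open>u + a\<close>, \<open>u + b\<close>, \<open>u\<close>
  yields \<open>a b\<^sup>T + b a\<^sup>T\<close>; unit vectors \<open>a\<close>, \<open>b\<close> then give a spanning set of the symmetric
  matrices.
\<close>

text \<open>The coefficients are unconstrained reals, so the hull is cut out of \<open>W\<close> by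
  a linear span. An element of the span uses a finite set of edge measures, which is enumerated to
  match the indexed sum in \<open>m_hull\<close>.\<close>

lemma m_hull_eq_span:
  fixes V :: "(real ^ 'x ^ 'x) set"
  shows "m_hull V = {P \<in> W. edge_measure P \<in> span (edge_measure ` V)}"
proof (intro set_eqI iffI)
  fix P assume "P \<in> m_hull V"
  then obtain k \<alpha> Ps where P: "P \<in> W" and Ps: "\<forall>i\<in>{1..k}. Ps i \<in> V"
    and sum: "edge_measure P = (\<Sum>i = (1::nat)..k. \<alpha> i *\<^sub>R edge_measure (Ps i))"
    unfolding m_hull_def by blast
  have "edge_measure P \<in> span (edge_measure ` V)"
    unfolding sum using Ps by (intro span_sum span_scale span_base imageI) blast
  with P show "P \<in> {P \<in> W. edge_measure P \<in> span (edge_measure ` V)}" by simp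
next
  fix P assume "P \<in> {P \<in> W. edge_measure P \<in> span (edge_measure ` V)}"
  then obtain t r where P: "P \<in> W" and t: "finite t" "t \<subseteq> edge_measure ` V"
    and sum: "edge_measure P = (\<Sum>a\<in>t. r a *\<^sub>R a)"
    unfolding span_explicit by auto
  obtain h where h: "bij_betw h {1..card t} t"
    using ex_bij_betw_nat_finite_1[OF t(1)] by blast
  \<comment> \<open>Any preimage in \<open>V\<close> serves: a kernel enters the sum only through
    its edge measure.\<close>
  define Ps where "Ps i = inv_into V edge_measure (h i)" for i
  have "h i \<in> edge_measure ` V" if "i \<in> {1..card t}" for i
    using bij_betwE[OF h] that t(2) by blast
  then have Ps: "Ps i \<in> V" "edge_measure (Ps i) = h i" if "i \<in> {1..card t}" for i
    using that unfolding Ps_def by (simp_all add: inv_into_into f_inv_into_f)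
  have "edge_measure P = (\<Sum>i = 1..card t. r (h i) *\<^sub>R h i)"
    unfolding sum by (rule sum.reindex_bij_betw[OF h, symmetric])
  also have "\<dots> = (\<Sum>i = 1..card t. r (h i) *\<^sub>R edge_measure (Ps i))"
    by (rule sum.cong) (simp_all add: Ps)
  finally show "P \<in> m_hull V"
    using P Ps(1) unfolding m_hull_def by (intro CollectI conjI exI) auto
qed

definition outer_product :: "real ^ 'x \<Rightarrow> real ^ 'x \<Rightarrow> real ^ 'x ^ 'x" where
  "outer_product a b = (\<chi> x x'. a $ x * b $ x')"

lemma reversible_iff_symmetric:
  "reversible P \<longleftrightarrow> transpose (edge_measure P) = edge_measure P"
  unfolding reversible_def edge_measure_def transpose_def by (auto simp: vec_eq_iff)

lemma subspace_symmetric_matrices: "subspace {Q :: real ^ 'x ^ 'x. transpose Q = Q}"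
  by (auto simp: subspace_def transpose_def vec_eq_iff)

text \<open>A matrix with all rows \<open>p\<close> sends each vector to its total mass times
  \<open>p\<close>, hence fixes \<open>p\<close>; uniqueness does the rest.\<close>

lemma stationary_dist_constant_rows:
  fixes P :: "real ^ 'x ^ 'x"
  assumes "P \<in> W" "distribution p" "\<And>x x'. P $ x $ x' = p $ x'"
  shows "stationary_dist P = p"
proof -
  have "p v* P = p"
    using assms(2,3)
    by (simp add: vector_matrix_mult_def vec_eq_iff distribution_def flip: sum_distrib_right)
  then show ?thesis
    unfolding stationary_dist_def using stationary_ex1[OF assms(1)] assms(2)
    by (intro the1_equality) auto
qed

lemma edge_measure_W_iid:
  "edge_measure ` (W_iid :: (real ^ 'x ^ 'x) set) =
     {outer_product p p |p. distribution p \<and> (\<forall>x. p $ x > 0)}" (is "?L = ?R")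
proof (intro set_eqI iffI)
  fix Q assume "Q \<in> ?L"
  then obtain P p where Q: "Q = edge_measure P" and P: "P \<in> W"
    and p: "distribution p" "\<forall>x. p $ x > 0" "\<And>x x'. P $ x $ x' = p $ x'"
    by (auto simp: W_iid_def memoryless_def)
  have "Q = outer_product p p"
    using stationary_dist_constant_rows[OF P p(1) p(3)] p(3)
    by (simp add: Q edge_measure_def outer_product_def)
  then show "Q \<in> ?R" using p by blast
next
  fix Q assume "Q \<in> ?R"
  then obtain p where Q: "Q = outer_product p p" and p: "distribution p" "\<forall>x. p $ x > 0"
    by blast
  define P :: "real ^ 'x ^ 'x" where "P = (\<chi> x. p)"
  have P: "P \<in> W" using p by (simp add: W_def P_def distribution_def)
  then have "P \<in> W_iid" using p by (auto simp: W_iid_def memoryless_def P_def)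
  moreover have "edge_measure P = Q"
    using stationary_dist_constant_rows[OF P p(1)]
    by (simp add: Q edge_measure_def outer_product_def P_def)
  ultimately show "Q \<in> ?L" by blast
qed

lemma outer_product_in_span_W_iid:
  fixes v :: "real ^ 'x"
  assumes "\<And>x. v $ x > 0"
  shows "outer_product v v \<in> span (edge_measure ` W_iid)"
proof -
  \<comment> \<open>Normalising by the mass \<open>s\<close> gives a distribution; the outer product
    is quadratic, so undoing this costs \<open>s\<^sup>2\<close>.\<close>
  define s where "s = (\<Sum>x\<in>UNIV. v $ x)"
  have s: "s > 0" unfolding s_def using assms by (intro sum_pos) auto
  define p where "p = (1 / s) *\<^sub>R v"
  have "distribution p" "\<forall>x. p $ x > 0"
    using s assms by (auto simp: p_def distribution_def less_imp_le s_def
        simp flip: sum_divide_distrib)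
  then have "outer_product p p \<in> edge_measure ` W_iid"
    unfolding edge_measure_W_iid by blast
  then have "s\<^sup>2 *\<^sub>R outer_product p p \<in> span (edge_measure ` W_iid)"
    by (intro span_scale span_base)
  moreover have "s\<^sup>2 *\<^sub>R outer_product p p = outer_product v v"
    using s by (simp add: p_def outer_product_def vec_eq_iff power2_eq_square)
  ultimately show ?thesis by simp
qed

lemma symmetrized_outer_product_in_span_W_iid:
  fixes a b :: "real ^ 'x"
  assumes "\<And>x. a $ x \<ge> 0" "\<And>x. b $ x \<ge> 0"
  shows "outer_product a b + outer_product b a \<in> span (edge_measure ` W_iid)"
proof -
  \<comment> \<open>Adding \<open>u\<close> keeps all four squared vectors strictly positive even
    where \<open>a\<close> or \<open>b\<close> vanishes, as unit vectors do.\<close>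
  define u :: "real ^ 'x" where "u = (\<chi> x. 1)"
  let ?sq = "\<lambda>v :: real ^ 'x. outer_product v v"
  have "outer_product a b + outer_product b a = ?sq (u + a + b) - ?sq (u + a) - ?sq (u + b) + ?sq u"
    by (simp add: vec_eq_iff outer_product_def algebra_simps)
  also have "\<dots> \<in> span (edge_measure ` W_iid)"
    using assms
    by (intro span_add span_diff outer_product_in_span_W_iid)
       (auto simp: u_def intro!: add_pos_nonneg add_nonneg_nonneg)
  finally show ?thesis .
qed

text \<open>The factor 1/2 compensates for each off-diagonal pair occurring in both orders and for
  each diagonal unit being added to itself.\<close>

lemma symmetric_matrix_expansion:
  fixes Q :: "real ^ 'x ^ 'x"
  assumes "transpose Q = Q"
  shows "Q = (\<Sum>x\<in>UNIV. \<Sum>y\<in>UNIV. (Q $ x $ y / 2) *\<^sub>R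
           (outer_product (axis x 1) (axis y 1) + outer_product (axis y 1) (axis x 1)))"
proof -
  have sym: "Q $ j $ i = Q $ i $ j" for i j
    using arg_cong[OF assms, of "\<lambda>M. M $ i $ j"] by (simp add: transpose_def)
  have delta: "(\<Sum>x\<in>UNIV. \<Sum>y\<in>UNIV. Q $ x $ y / 2 * (axis x 1 $ i * axis y 1 $ j)) = Q $ i $ j / 2"
    (is "(\<Sum>x\<in>UNIV. \<Sum>y\<in>UNIV. ?f x y) = _") for i j
  proof -
    have "?f x y = (if y = j then if x = i then Q $ i $ j / 2 else 0 else 0)" for x y
      by (simp add: axis_def)
    then show ?thesis by (simp only: sum.delta finite UNIV_I if_True)
  qed
  have "(\<Sum>x\<in>UNIV. \<Sum>y\<in>UNIV. Q $ x $ y / 2 * (axis x 1 $ i * axis y 1 $ j)) +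
      (\<Sum>x\<in>UNIV. \<Sum>y\<in>UNIV. Q $ x $ y / 2 * (axis y 1 $ i * axis x 1 $ j)) = Q $ i $ j" for i j
    using delta[of i j] delta[of j i] sym[of i j]
    \<comment> \<open>Commuting the factors turns the second sum into \<open>delta\<close> at the
      transposed position, so symmetry makes both halves equal.\<close>
    by (subst (2) mult.commute[of "axis _ 1 $ i"]) linarith
  then show ?thesis
    by (simp only: vec_eq_iff sum_component vector_scaleR_component vector_add_component
        outer_product_def vec_lambda_beta real_scaleR_def distrib_left sum.distrib simp_thms)
qed

lemma span_edge_measure_W_iid:
  "span (edge_measure ` W_iid) = {Q :: real ^ 'x ^ 'x. transpose Q = Q}"
proof (rule subset_antisym)
  show "span (edge_measure ` W_iid) \<subseteq> {Q :: real ^ 'x ^ 'x. transpose Q = Q}"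
    by (rule span_minimal[OF _ subspace_symmetric_matrices])
       (auto simp: edge_measure_W_iid outer_product_def transpose_def vec_eq_iff)
next
  show "{Q :: real ^ 'x ^ 'x. transpose Q = Q} \<subseteq> span (edge_measure ` W_iid)"
  proof
    fix Q :: "real ^ 'x ^ 'x"
    assume "Q \<in> {Q. transpose Q = Q}"
    then have "transpose Q = Q" by simp
    show "Q \<in> span (edge_measure ` W_iid)"
      by (subst symmetric_matrix_expansion[OF \<open>transpose Q = Q\<close>],
          intro span_sum span_scale symmetrized_outer_product_in_span_W_iid)
         (auto simp: axis_def)
  qed
qed

theorem theorem9p2:
  assumes "CARD('x::finite) \<ge> 2"
  shows "m_hull (W_iid :: (real ^ 'x ^ 'x) set) = W_rev"
  by (simp add: m_hull_eq_span span_edge_measure_W_iid W_rev_def reversible_iff_symmetric)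

end
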